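(* Let $i\in\mathcal I$, $j\in\mathcal J$, $z_0\in\mathcal Z_0$, $p\in\mathcal P$, and let $\mathcal S\in\overline{\mathcal S}_j(z_0)$ with right-angle vertex $w^{\mathrm{ctr}}_{\mathcal S}$. Define $$q_{i,j,\mathcal S}(w,p):=q_{i,j}(w^{\mathrm{ctr}}_{\mathcal S}+A_jp)+\frac{\partial q_{i,j}}{\partial w}(w^{\mathrm{ctr}}_{\mathcal S}+A_jp)\,(w-w^{\mathrm{ctr}}_{\mathcal S}-A_jp)+\tfrac12(w-w^{\mathrm{ctr}}_{\mathcal S}-A_jp)^\top H_{\mathcal S}\,(w-w^{\mathrm{ctr}}_{\mathcal S}-A_jp),$$ where $H_{\mathcal S}\in\mathbb R^{2\times 2}$ is generated by taking the element-wise supremum of the Hessian of $q_{i,j}$ over $\mathcal S\oplus A_j\mathcal P$ using interval arithmetic. Then for all $w\in\mathcal S+A_jp$, $$q_{i,j}(w)\le q_{i,j,\mathcal S}(w,p).$$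
   Context: Zonotope notation: for $c\in\mathbb R^n$ and $G=[g_1,\dots,g_\ell]\in\mathbb R^{n\times\ell}$, $\langle c,\;G\rangle=\{c+\sum_{k=1}^\ell\beta_kg_k\mid\beta_k\in[-1,1]\}$. $\mathcal W\subset\mathbb R^2$ is the world space; all planar sets considered (including the translated triangles $\mathcal S+A_jp$, $p\in\mathcal P$) lie in $\mathcal W$. $\mathcal I$ (obstacles) and $\mathcal J$ (time intervals) are finite index sets, $\mathcal Z_0\subset\mathbb R^6$ is the set of initial conditions, $\mathcal P\subset\mathbb R^{n_p}$ is the set of trajectory parameters. For each $(i,j)\in\mathcal I\times\mathcal J$, $q_{i,j}:\mathcal W\to[0,\infty)$ is a twice-differentiable probability density function; $\frac{\partial q_{i,j}}{\partial w}$ is its gradient as a row vector. $G^{\mathrm{obs}}$ is a constant matrix with 2 rows. For each $j$, $\xi_j(z_0,p)=\langle c_j(z_0)+A_jp,\;G_j\rangle\subset\mathbb R^2$ is the zonotope reachable set, with $c_j:\mathcal Z_0\to\mathbb R^2$ linear, $A_j\in\mathbb R^{2\times n_p}$, and $G_j$ a matrix with 2 rows. Triangles: for a fixed positive integer $k$, cover the zonotope $\langle c_j(z_0),\;[G_j,G^{\mathrm{obs}}]\rangle$ by an axis-aligned $k\times k$ grid of rectangular cells of equal size. Each cell is cut along the diagonal joining its upper-left and lower-right corners into two right-angled triangles: the lower one (index $1$), whose right-angle vertex is the lower-left corner of the cell, and the upper one (index $-1$), whose right-angle vertex is the upper-right corner. $\overline{\mathcal S}_j(z_0)$ is the collection of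 those triangles having nonempty intersection with $\langle c_j(z_0),\;[G_j,G^{\mathrm{obs}}]\rangle$. $\mathcal S\oplus A_j\mathcal P=\{s+A_jp'\mid s\in\mathcal S,\,p'\in\mathcal P\}$. Taking the element-wise supremum with interval arithmetic means that each entry of $H_{\mathcal S}$ is a finite real number that is at least the supremum of the corresponding entry of the Hessian of $q_{i,j}$ over $\mathcal S\oplus A_j\mathcal P$. *)

theory Defs
  imports "HOL-Analysis.Analysis"
begin

text \<open>
  A matrix with two rows is represented by the list of its columns, so that the number of
  generators can vary with the time interval and \<open>[G, G']\<close> is list append.
\<close>

definition zonotope :: "real^2 \<Rightarrow> (real^2) list \<Rightarrow> (real^2) set" where
  "zonotope c G =
    {c + (\<Sum>l<length G. \<beta> l *\<^sub>R G ! l) | \<beta>. \<forall>l<length G. \<beta> l \<in> {-1..1::real}}"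

definition is_pdf_on :: "(real^2) set \<Rightarrow> (real^2 \<Rightarrow> real) \<Rightarrow> bool" where
  "is_pdf_on W f \<longleftrightarrow>
    (\<forall>w\<in>W. 0 \<le> f w) \<and> set_integrable lebesgue W f \<and> (LINT w:W|lebesgue. f w) = 1"

text \<open>
  \<open>f\<close> is twice differentiable on \<open>W\<close> with gradient \<open>Df\<close> and Hessian \<open>Hf\<close>, where
  \<open>Hf w $ a $ b\<close> is the derivative in direction \<open>b\<close> of component \<open>a\<close> of \<open>Df\<close>. Derivatives are
  taken within \<open>W\<close>, because \<open>f\<close> stands for a function with domain \<open>W\<close>; only the values on \<open>W\<close>
  matter.
\<close>

definition twice_differentiable_on_with ::
    "(real^2) set \<Rightarrow> (real^2 \<Rightarrow> real) \<Rightarrow> (real^2 \<Rightarrow> real^2) \<Rightarrow> (real^2 \<Rightarrow> real^2^2) \<Rightarrow> bool" where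
  "twice_differentiable_on_with W f Df Hf \<longleftrightarrow>
    (\<forall>w\<in>W. (f has_derivative (\<lambda>h. Df w \<bullet> h)) (at w within W)) \<and>
    (\<forall>w\<in>W. (Df has_derivative (\<lambda>h. Hf w *v h)) (at w within W))"

text \<open>
  A grid is given by its lower-left corner \<open>org\<close> and the side lengths \<open>d\<close> of its cells. The cell
  \<open>(a, b)\<close> has lower-left corner \<open>grid_node org d a b\<close> and upper-right corner
  \<open>grid_node org d (a + 1) (b + 1)\<close>.
\<close>

definition grid_node :: "real^2 \<Rightarrow> real^2 \<Rightarrow> nat \<Rightarrow> nat \<Rightarrow> real^2" where
  "grid_node org d a b = vector [org $ 1 + real a * d $ 1, org $ 2 + real b * d $ 2]"

definition grid_cell :: "real^2 \<Rightarrow> real^2 \<Rightarrow> nat \<Rightarrow> nat \<Rightarrow> (real^2) set" where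
  "grid_cell org d a b = cbox (grid_node org d a b) (grid_node org d (a + 1) (b + 1))"

definition grid_covers :: "nat \<Rightarrow> real^2 \<Rightarrow> real^2 \<Rightarrow> (real^2) set \<Rightarrow> bool" where
  "grid_covers k org d X \<longleftrightarrow>
    0 < d $ 1 \<and> 0 < d $ 2 \<and> X \<subseteq> (\<Union>a<k. \<Union>b<k. grid_cell org d a b)"

text \<open>The lower triangle of a cell has index \<open>1\<close>, the upper one has index \<open>-1\<close>.\<close>

definition right_angle_vertex :: "real^2 \<Rightarrow> real^2 \<Rightarrow> nat \<Rightarrow> nat \<Rightarrow> int \<Rightarrow> real^2" where
  "right_angle_vertex org d a b \<sigma> =
    (if \<sigma> = 1 then grid_node org d a b else grid_node org d (a + 1) (b + 1))"

definition cell_triangle :: "real^2 \<Rightarrow> real^2 \<Rightarrow> nat \<Rightarrow> nat \<Rightarrow> int \<Rightarrow> (real^2) set" where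
  "cell_triangle org d a b \<sigma> =
    convex hull {right_angle_vertex org d a b \<sigma>,
                 grid_node org d a (b + 1), grid_node org d (a + 1) b}"

text \<open>The triangles meeting \<open>X\<close>, each paired with its right-angle vertex.\<close>

definition triangles_meeting ::
    "nat \<Rightarrow> real^2 \<Rightarrow> real^2 \<Rightarrow> (real^2) set \<Rightarrow> ((real^2) set \<times> (real^2)) set" where
  "triangles_meeting k org d X =
    {(cell_triangle org d a b \<sigma>, right_angle_vertex org d a b \<sigma>) | a b \<sigma>.
      a < k \<and> b < k \<and> \<sigma> \<in> {1, -1} \<and> cell_triangle org d a b \<sigma> \<inter> X \<noteq> {}}"

definition sum_with_image :: "(real^2) set \<Rightarrow> real^'n^2 \<Rightarrow> (real^'n) set \<Rightarrow> (real^2) set" where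
  "sum_with_image S A P = {s + A *v p | s p. s \<in> S \<and> p \<in> P}"

text \<open>
  The supremum is taken in the extended reals, so an entry that is unbounded above on \<open>X\<close>
  admits no bound.
\<close>

definition entrywise_sup_bound :: "(real^2 \<Rightarrow> real^2^2) \<Rightarrow> (real^2) set \<Rightarrow> real^2^2 \<Rightarrow> bool" where
  "entrywise_sup_bound Hf X H \<longleftrightarrow>
    (\<forall>a b. (SUP x\<in>X. ereal (Hf x $ a $ b)) \<le> ereal (H $ a $ b))"

definition quadratic_model ::
    "(real^2 \<Rightarrow> real) \<Rightarrow> (real^2 \<Rightarrow> real^2) \<Rightarrow> real^2^2 \<Rightarrow> real^'n^2 \<Rightarrow> real^2 \<Rightarrow>
      real^2 \<Rightarrow> real^'n \<Rightarrow> real" where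
  "quadratic_model f Df H A wctr w p =
    f (wctr + A *v p)
    + Df (wctr + A *v p) \<bullet> (w - wctr - A *v p)
    + 1 / 2 * ((w - wctr - A *v p) \<bullet> (H *v (w - wctr - A *v p)))"

end

theory Submission
  imports Defs
begin

text \<open>
  Seen from the right-angle vertex, all points of a triangle lie in the same closed quadrant
  (first or third), so a displacement \<open>u\<close> has \<open>u $ a * u $ b \<ge> 0\<close> for all \<open>a\<close>, \<open>b\<close>. Hence
  bounding the Hessian entrywise bounds its quadratic form at \<open>u\<close>, and Taylor's inequality along
  the segment from the vertex, which stays in the translated triangle by convexity, gives the claim.
\<close>

text \<open>Monotonicity is used twice. Since \<open>g''\<close> is at most \<open>M\<close>,
  subtracting \<open>s * M\<close> from \<open>g'\<close> leaves a nonincreasing function, so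
  \<open>g'\<close> grows at most linearly; subtracting the antiderivative of that linear bound from
  \<open>g\<close> again leaves a nonincreasing function. This suits a \<open>g''\<close> that may
  be discontinuous.\<close>

lemma taylor2_upper_bound_real:
  fixes g g' g'' :: "real \<Rightarrow> real"
  assumes g: "\<And>t. t \<in> {0..1} \<Longrightarrow> (g has_real_derivative g' t) (at t within {0..1})"
    and g': "\<And>t. t \<in> {0..1} \<Longrightarrow> (g' has_real_derivative g'' t) (at t within {0..1})"
    and M: "\<And>t. t \<in> {0..1} \<Longrightarrow> g'' t \<le> M"
  shows "g 1 \<le> g 0 + g' 0 + M / 2"
proof -
  have slope: "g' t \<le> g' 0 + t * M" if t: "t \<in> {0..1}" for t
  proof -
    define h where "h = (\<lambda>s. g' s - s * M)"
    have h': "(h has_real_derivative g'' s - M) (at s within {0..1})" if "s \<in> {0..1}" for s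
      unfolding h_def using that by (auto intro!: derivative_eq_intros g')
    \<comment> \<open>At 0 and 1 only one-sided derivatives are available, hence the rule that asks
      for derivatives in the open interval and continuity up to the ends.\<close>
    have "h 0 \<ge> h t"
    proof (rule DERIV_nonpos_imp_decreasing_open[of 0 t h])
      show "0 \<le> t" using t by simp
      show "\<exists>y. (h has_real_derivative y) (at s) \<and> y \<le> 0" if "0 < s" "s < t" for s
      proof -
        have s: "0 < s" "s < 1" using that t by auto
        then show ?thesis
          using h'[of s] M[of s] by (auto simp: at_within_Icc_at intro!: exI[of _ "g'' s - M"])
      qed
      have "continuous_on {0..1} h"
        using h' by (rule DERIV_continuous_on)
      then show "continuous_on {0..t} h"
        by (rule continuous_on_subset) (use t in auto)
    qed
    then show ?thesis by (simp add: h_def)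
  qed
  \<comment> \<open>The subtracted terms integrate the bound \<open>g' 0 + s * M\<close> from
    \<open>slope\<close>, so \<open>h 1 \<le> h 0\<close> is exactly the claim.\<close>
  define h where "h = (\<lambda>s. g s - s * g' 0 - s\<^sup>2 / 2 * M)"
  have h': "(h has_real_derivative g' s - g' 0 - s * M) (at s within {0..1})"
    if "s \<in> {0..1}" for s
    unfolding h_def using that by (auto intro!: derivative_eq_intros g)
  have "h 0 \<ge> h 1"
  proof (rule DERIV_nonpos_imp_decreasing_open[of 0 1 h])
    show "\<exists>y. (h has_real_derivative y) (at s) \<and> y \<le> 0" if "0 < s" "s < 1" for s
      using that h'[of s] slope[of s]
      by (auto simp: at_within_Icc_at intro!: exI[of _ "g' s - g' 0 - s * M"])
    show "continuous_on {0..1} h"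
      using h' by (rule DERIV_continuous_on)
  qed simp
  then show ?thesis by (simp add: h_def)
qed

text \<open>Restriction to the segment from \<open>x\<close> to \<open>w\<close> reduces this to one
  variable. \<open>M\<close> only has to bound second derivatives in the direction
  \<open>w - x\<close>, so it may depend on the two endpoints.\<close>

lemma taylor2_upper_bound:
  fixes f :: "'a::real_inner \<Rightarrow> real" and Df :: "'a \<Rightarrow> 'a" and Hf :: "'a \<Rightarrow> 'a \<Rightarrow> 'a"
  assumes seg: "closed_segment x w \<subseteq> W"
    and f: "\<And>y. y \<in> W \<Longrightarrow> (f has_derivative (\<lambda>h. Df y \<bullet> h)) (at y within W)"
    and Df: "\<And>y. y \<in> W \<Longrightarrow> (Df has_derivative Hf y) (at y within W)"
    and M: "\<And>y. y \<in> closed_segment x w \<Longrightarrow> (w - x) \<bullet> Hf y (w - x) \<le> M"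
  shows "f w \<le> f x + Df x \<bullet> (w - x) + M / 2"
proof -
  define u where "u = w - x"
  define l where "l = (\<lambda>t::real. x + t *\<^sub>R u)"
  have l_seg: "l t \<in> closed_segment x w" if "t \<in> {0..1}" for t
    using that unfolding l_def u_def closed_segment_def
    by (auto simp: algebra_simps intro!: exI[of _ t])
  have lW: "l ` {0..1} \<subseteq> W" using l_seg seg by auto
  have dl: "(l has_derivative (\<lambda>h. h *\<^sub>R u)) (at t within {0..1})" for t
    unfolding l_def by (auto intro!: derivative_eq_intros)
  \<comment> \<open>The segment may run along the boundary of \<open>W\<close>, so derivatives
    within \<open>W\<close> are first restricted to the image of \<open>l\<close>. \<open>F\<close>
    is generic because both \<open>f\<close> and \<open>Df\<close> are composed with
    \<open>l\<close>.\<close>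
  have chain: "((\<lambda>t. F (l t)) has_derivative (\<lambda>h. F' (h *\<^sub>R u))) (at t within {0..1})"
    if "t \<in> {0..1}" "(F has_derivative F') (at (l t) within W)"
    for F :: "'a \<Rightarrow> 'b::real_normed_vector" and F' t
    by (rule has_derivative_in_compose[OF dl has_derivative_subset[OF that(2) lW]])
  have g: "((\<lambda>t. f (l t)) has_real_derivative Df (l t) \<bullet> u) (at t within {0..1})"
    if t: "t \<in> {0..1}" for t
  proof -
    have "l t \<in> W" using lW t by auto
    then show ?thesis
      using chain[OF t f] by (simp add: has_field_derivative_def mult_commute_abs)
  qed
  have g': "((\<lambda>t. Df (l t) \<bullet> u) has_real_derivative u \<bullet> Hf (l t) u) (at t within {0..1})"
    if t: "t \<in> {0..1}" for t
  proof -
    have lt: "l t \<in> W" using lW t by auto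
    have "linear (Hf (l t))"
      using Df[OF lt] by (rule has_derivative_linear)
    then have "Hf (l t) (h *\<^sub>R u) \<bullet> u = (u \<bullet> Hf (l t) u) * h" for h
      by (simp add: linear_scale inner_commute)
    then show ?thesis
      using has_derivative_inner_left[OF chain[OF t Df[OF lt]], of u]
      by (simp add: has_field_derivative_def)
  qed
  have "f (l 1) \<le> f (l 0) + Df (l 0) \<bullet> u + M / 2"
    by (rule taylor2_upper_bound_real[OF g g']) (use M l_seg in \<open>auto simp: u_def\<close>)
  then show ?thesis by (simp add: l_def u_def)
qed

text \<open>Expanded over index pairs, the form weights each matrix entry by
  \<open>u $ a * u $ b\<close>, so the comparison is termwise. A negative weight would reverse it
  for an off-diagonal entry.\<close>

lemma quadratic_form_mono:
  fixes u :: "real^'n" and A B :: "real^'n^'n"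
  assumes "\<And>a b. A $ a $ b \<le> B $ a $ b" and "\<And>a b. 0 \<le> u $ a * u $ b"
  shows "u \<bullet> (A *v u) \<le> u \<bullet> (B *v u)"
proof -
  have "u \<bullet> (C *v u) = (\<Sum>a\<in>UNIV. \<Sum>b\<in>UNIV. C $ a $ b * (u $ a * u $ b))" for C :: "real^'n^'n"
    by (simp add: inner_vec_def matrix_vector_mult_def sum_distrib_left mult_ac)
  then show ?thesis
    by (simp only:) (intro sum_mono mult_right_mono assms)
qed

text \<open>Both legs at the right angle are parallel to the axes and point either right and up or
  left and down. Barycentric coordinates write the displacement as a nonnegative combination of the
  legs.\<close>

lemma cell_triangle_same_quadrant:
  assumes d: "0 < d $ 1" "0 < d $ 2"
    and s: "s \<in> cell_triangle org d i j \<sigma>"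
  shows "0 \<le> (s - right_angle_vertex org d i j \<sigma>) $ a * (s - right_angle_vertex org d i j \<sigma>) $ b"
proof -
  let ?v = "right_angle_vertex org d i j \<sigma>"
  obtain x y z where xyz: "0 \<le> x" "0 \<le> y" "0 \<le> z" "x + y + z = 1"
    and s_eq: "s = x *\<^sub>R ?v + y *\<^sub>R grid_node org d i (j + 1) + z *\<^sub>R grid_node org d (i + 1) j"
    using s unfolding cell_triangle_def convex_hull_3 by auto
  have x: "x = 1 - y - z" using xyz by simp
  define \<epsilon> :: real where "\<epsilon> = (if \<sigma> = 1 then 1 else -1)"
  have eps: "\<epsilon> * \<epsilon> = 1" by (simp add: \<epsilon>_def)
  \<comment> \<open>The roles of \<open>y\<close> and \<open>z\<close> swap because node
    \<open>(i, j + 1)\<close> lies above the right-angle vertex in the lower triangle but to its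
    left in the upper one. The common sign \<open>\<epsilon>\<close> cancels in the product.\<close>
  define r :: "real^2" where "r = (if \<sigma> = 1 then vector [z * d $ 1, y * d $ 2]
    else vector [y * d $ 1, z * d $ 2])"
  have "s - ?v = \<epsilon> *\<^sub>R r"
    unfolding s_eq x r_def \<epsilon>_def
    by (simp add: vec_eq_iff forall_2 right_angle_vertex_def grid_node_def algebra_simps)
  moreover have r_nonneg: "0 \<le> r $ c" for c
    using exhaust_2[of c] xyz d by (auto simp: r_def)
  ultimately have "(s - ?v) $ a * (s - ?v) $ b = (\<epsilon> * \<epsilon>) * (r $ a * r $ b)"
    by simp
  then show ?thesis
    using r_nonneg by (simp add: eps)
qed

theorem lemma12:
  fixes W :: "(real^2) set"
    and I :: "'i set"
    and J :: "'j set"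
    and Z0 :: "(real^6) set"
    and P :: "(real^'np) set"
    and q :: "'i \<Rightarrow> 'j \<Rightarrow> real^2 \<Rightarrow> real"
    and Dq :: "'i \<Rightarrow> 'j \<Rightarrow> real^2 \<Rightarrow> real^2"
    and Hq :: "'i \<Rightarrow> 'j \<Rightarrow> real^2 \<Rightarrow> real^2^2"
    and Gobs :: "(real^2) list"
    and G :: "'j \<Rightarrow> (real^2) list"
    and c :: "'j \<Rightarrow> real^6 \<Rightarrow> real^2"
    and A :: "'j \<Rightarrow> real^'np^2"
    and k :: nat
    and org d :: "'j \<Rightarrow> real^6 \<Rightarrow> real^2"
    and i :: 'i and j :: 'j and z0 :: "real^6" and p :: "real^'np"
    and S :: "(real^2) set" and wctr :: "real^2" and H :: "real^2^2"
  assumes "finite I" and "finite J"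
    and pdf: "\<And>i j. i \<in> I \<Longrightarrow> j \<in> J \<Longrightarrow> is_pdf_on W (q i j)"
    and twice_diff: "\<And>i j. i \<in> I \<Longrightarrow> j \<in> J \<Longrightarrow>
      twice_differentiable_on_with W (q i j) (Dq i j) (Hq i j)"
    and linear_c: "\<And>j. j \<in> J \<Longrightarrow> linear (c j)"
    and "0 < k"
    and grid: "\<And>j z. j \<in> J \<Longrightarrow> z \<in> Z0 \<Longrightarrow>
      grid_covers k (org j z) (d j z) (zonotope (c j z) (G j @ Gobs))"
    and in_world: "\<And>j z T v p. j \<in> J \<Longrightarrow> z \<in> Z0 \<Longrightarrow> p \<in> P \<Longrightarrow>
      (T, v) \<in> triangles_meeting k (org j z) (d j z) (zonotope (c j z) (G j @ Gobs)) \<Longrightarrow>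
      (\<lambda>s. s + A j *v p) ` T \<subseteq> W"
    and "i \<in> I" and "j \<in> J" and "z0 \<in> Z0" and "p \<in> P"
    and S: "(S, wctr) \<in>
      triangles_meeting k (org j z0) (d j z0) (zonotope (c j z0) (G j @ Gobs))"
    and H: "entrywise_sup_bound (Hq i j) (sum_with_image S (A j) P) H"
  shows "\<forall>w \<in> (\<lambda>s. s + A j *v p) ` S.
    q i j w \<le> quadratic_model (q i j) (Dq i j) H (A j) wctr w p"
proof
  fix w assume "w \<in> (\<lambda>s. s + A j *v p) ` S"
  then obtain s where s: "s \<in> S" and w: "w = s + A j *v p" by auto
  obtain a b \<sigma> where S_eq: "S = cell_triangle (org j z0) (d j z0) a b \<sigma>"
    and v_eq: "wctr = right_angle_vertex (org j z0) (d j z0) a b \<sigma>"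
    using S unfolding triangles_meeting_def by auto
  let ?x = "wctr + A j *v p" and ?T = "(\<lambda>s. s + A j *v p) ` S"
  have wx: "w - ?x = s - wctr" by (simp add: w)
  have "wctr \<in> S"
    unfolding S_eq v_eq cell_triangle_def by (simp add: hull_inc)
  moreover have "convex ?T"
    using convex_translation[of S "A j *v p"]
    by (simp add: S_eq cell_triangle_def add.commute)
  ultimately have seg: "closed_segment ?x w \<subseteq> ?T"
    using s w by (intro closed_segment_subset) auto
  have "?T \<subseteq> W"
    using in_world \<open>j \<in> J\<close> \<open>z0 \<in> Z0\<close> \<open>p \<in> P\<close> S by blast
  then have segW: "closed_segment ?x w \<subseteq> W" using seg by blast
  have "0 < d j z0 $ 1" "0 < d j z0 $ 2"
    using grid[OF \<open>j \<in> J\<close> \<open>z0 \<in> Z0\<close>] by (auto simp: grid_covers_def)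
  then have quadrant: "0 \<le> (w - ?x) $ a' * (w - ?x) $ b'" for a' b'
    unfolding wx unfolding v_eq using s S_eq by (blast intro: cell_triangle_same_quadrant)
  \<comment> \<open>The right-hand side serves as \<open>M\<close> in
    \<open>taylor2_upper_bound\<close>: it depends on \<open>w\<close> but not on the point
    \<open>y\<close> of the segment.\<close>
  have "(w - ?x) \<bullet> (Hq i j y *v (w - ?x)) \<le> (w - ?x) \<bullet> (H *v (w - ?x))"
    if y: "y \<in> closed_segment ?x w" for y
  proof (rule quadratic_form_mono[OF _ quadrant])
    fix a' b'
    \<comment> \<open>The given \<open>p\<close> itself is the witness from \<open>P\<close>: the
      segment stays in the translate of \<open>S\<close> by \<open>A j *v p\<close>.\<close>
    have "y \<in> sum_with_image S (A j) P"
      using y seg \<open>p \<in> P\<close> unfolding sum_with_image_def by blast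
    \<comment> \<open>In the complete lattice \<open>ereal\<close> the supremum is an upper bound
      without a boundedness proof; comparison with the finite entry of \<open>H\<close> leads back
      to the reals.\<close>
    then have "ereal (Hq i j y $ a' $ b') \<le> (SUP x\<in>sum_with_image S (A j) P. ereal (Hq i j x $ a' $ b'))"
      by (rule SUP_upper)
    also have "\<dots> \<le> ereal (H $ a' $ b')"
      using H by (simp add: entrywise_sup_bound_def)
    finally show "Hq i j y $ a' $ b' \<le> H $ a' $ b'" by simp
  qed
  moreover have "twice_differentiable_on_with W (q i j) (Dq i j) (Hq i j)"
    using twice_diff \<open>i \<in> I\<close> \<open>j \<in> J\<close> by blast
  ultimately have "q i j w \<le> q i j ?x + Dq i j ?x \<bullet> (w - ?x) + (w - ?x) \<bullet> (H *v (w - ?x)) / 2"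
    by (intro taylor2_upper_bound[OF segW, where Hf = "\<lambda>y h. Hq i j y *v h"])
      (auto simp: twice_differentiable_on_with_def)
  then show "q i j w \<le> quadratic_model (q i j) (Dq i j) H (A j) wctr w p"
    by (simp add: quadratic_model_def diff_diff_eq)
qed

end
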